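(* Let $H$ be a quaternion skew field with centre $F$, and let $\mathcal{A}(H)$ be the set of all lines of $\mathbb{P}(H)$ through the point $F1$. (a) Upon choosing any subset $\mathcal{D}$ of $\mathcal{A}(H)$, let $$\mathcal{F}:=\bigcup_{X\in\mathcal{D},\,c\in H^*}\{c^{-1}Xc\}.$$ Then $$\Pi_{\mathcal{F}}:=\{\mathcal{S}_{\ell}(L)\mid L\in\mathcal{F}\}\cup\{\mathcal{S}_{r}(L)\mid L\in\mathcal{A}(H)\setminus\mathcal{F}\}$$ is the set of parallel classes of a Clifford-like parallelism, denoted $\parallel_{\mathcal{F}}$, of the projective double space $(\mathbb{P}(H),\parallel_{\ell},\parallel_{r})$. (b) Conversely, any Clifford-like parallelism $\parallel$ of $(\mathbb{P}(H),\parallel_{\ell},\parallel_{r})$ arises in the way described in (a) from at least one subset $\mathcal{D}$ of $\mathcal{A}(H)$. (c) Let $\mathcal{D}$ and $\tilde{\mathcal{D}}$ be subsets of $\mathcal{A}(H)$, and let applying the construction from (a) to $\mathcal{D}$ and $\tilde{\mathcal{D}}$ give the sets $\mathcal{F}$, $\tilde{\mathcal{F}}$ and the parallelisms $\parallel_{\mathcal{F}}$, $\parallel_{\tilde{\mathcal{F}}}$, respectively. Then $\parallel_{\mathcal{F}}$ coincides with $\parallel_{\tilde{\mathcal{F}}}$ if, and only if, $\mathcal{F}=\tilde{\mathcal{F}}$.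
   Context: A quaternion skew field $H$ with centre $F$ is a quaternion algebra over the field $F$ (of any characteristic), $4$-dimensional over $F$, that is a skew field with centre $F$; $H^*:=H\setminus\{0\}$. The projective space $\mathbb{P}(H)$ is the set of all subspaces of the $F$-vector space $H$; its points and lines are the subspaces of vector dimension one and two, respectively. For lines $M,N$: $M\parallel_{\ell}N$ (left parallel) if there is a $c\in H^*$ with $cM=N$; $M\parallel_{r}N$ (right parallel) if there is a $d\in H^*$ with $Md=N$. The left and right parallel classes of a line $M$ are denoted by $\mathcal{S}_{\ell}(M)$ and $\mathcal{S}_{r}(M)$. A parallelism on a projective space is an equivalence relation on its set of lines such that each point is incident with precisely one line from each equivalence class (parallel class). A projective space with parallelisms $\parallel_{\ell}$ and $\parallel_{r}$ is a projective double space if for all triangles $p_0,p_1,p_2$ the line $M_1$ through $p_2$ that is left parallel to the join of $p_0$ and $p_1$, and the line $M_2$ through $p_1$ that is right parallel to the join of $p_0$ and $p_2$, have a common point. It is known that $(\mathbb{P}(H),\parallel_{\ell},\parallel_{r})$ is a projective double space. A Clifford-like parallelism of $(\mathbb{P}(H),\parallel_{\ell},\parallel_{r})$ is a parallelism $\parallel$ on $\mathbb{P}(H)$ such that for all lines $M,N$: $M\parallel N$ implies ($M\parallel_{\ell}N$ or $M\parallel_{r}N$). *)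

theory Defs
  imports Complex_Main
begin

section \<open>A skew field as a vector space over its centre\<close>

text \<open>
  A skew field is a type of class \<^class>\<open>division_ring\<close>.  Its centre is made into a
  type, so that it can serve as the field of scalars in the locale \<^locale>\<open>vector_space\<close>.
\<close>

typedef (overloaded) 'a centre = "{z :: 'a::division_ring. \<forall>x. z * x = x * z}"
  by (rule exI[of _ 0]) simp

lemma Rep_centre_commutes: "Rep_centre a * x = x * Rep_centre a"
  using Rep_centre[of a] by simp

lemma inverse_commutes:
  fixes z x :: "'a::division_ring"
  assumes "z * x = x * z"
  shows "inverse z * x = x * inverse z"
proof (cases "z = 0")
  case False
  have "inverse z * x = inverse z * (x * z) * inverse z"
    using False by (simp add: mult.assoc)
  also have "\<dots> = inverse z * (z * x) * inverse z"
    by (simp only: assms)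
  also have "\<dots> = (inverse z * z) * x * inverse z"
    by (simp only: mult.assoc)
  finally show ?thesis
    using False by simp
qed simp

instantiation centre :: (division_ring) field
begin

definition zero_centre :: "'a centre" where "0 = Abs_centre 0"
definition one_centre :: "'a centre" where "1 = Abs_centre 1"
definition plus_centre :: "'a centre \<Rightarrow> 'a centre \<Rightarrow> 'a centre"
  where "a + b = Abs_centre (Rep_centre a + Rep_centre b)"
definition uminus_centre :: "'a centre \<Rightarrow> 'a centre"
  where "- a = Abs_centre (- Rep_centre a)"
definition minus_centre :: "'a centre \<Rightarrow> 'a centre \<Rightarrow> 'a centre"
  where "a - b = Abs_centre (Rep_centre a - Rep_centre b)"
definition times_centre :: "'a centre \<Rightarrow> 'a centre \<Rightarrow> 'a centre"
  where "a * b = Abs_centre (Rep_centre a * Rep_centre b)"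
definition inverse_centre :: "'a centre \<Rightarrow> 'a centre"
  where "inverse a = Abs_centre (inverse (Rep_centre a))"
definition divide_centre :: "'a centre \<Rightarrow> 'a centre \<Rightarrow> 'a centre"
  where "a div b = Abs_centre (Rep_centre a / Rep_centre b)"

lemma Rep_centre_simps [simp]:
  "Rep_centre 0 = 0"
  "Rep_centre 1 = 1"
  "Rep_centre (a + b) = Rep_centre a + Rep_centre b"
  "Rep_centre (- a) = - Rep_centre a"
  "Rep_centre (a - b) = Rep_centre a - Rep_centre b"
  "Rep_centre (a * b) = Rep_centre a * Rep_centre b"
  "Rep_centre (inverse a) = inverse (Rep_centre a)"
  "Rep_centre (a div b) = Rep_centre a / Rep_centre b"
proof -
  have comm: "Rep_centre c * x = x * Rep_centre c" for c :: "'a centre" and x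
    by (rule Rep_centre_commutes)
  have inv: "inverse (Rep_centre c) * x = x * inverse (Rep_centre c)" for c :: "'a centre" and x
    by (rule inverse_commutes) (rule comm)
  have mult: "u * v * x = x * (u * v)"
    if u: "\<And>x. u * x = x * u" and v: "\<And>x. v * x = x * v" for u v x :: 'a
    by (metis u v mult.assoc)
  show "Rep_centre 0 = 0"
    unfolding zero_centre_def by (rule Abs_centre_inverse) simp
  show "Rep_centre 1 = 1"
    unfolding one_centre_def by (rule Abs_centre_inverse) simp
  show "Rep_centre (a + b) = Rep_centre a + Rep_centre b"
    unfolding plus_centre_def
    by (rule Abs_centre_inverse)
       (simp add: distrib_left distrib_right, metis comm)
  show "Rep_centre (- a) = - Rep_centre a"
    unfolding uminus_centre_def by (rule Abs_centre_inverse) (simp, metis comm)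
  show "Rep_centre (a - b) = Rep_centre a - Rep_centre b"
    unfolding minus_centre_def
    by (rule Abs_centre_inverse) (simp add: left_diff_distrib right_diff_distrib, metis comm)
  show "Rep_centre (a * b) = Rep_centre a * Rep_centre b"
    unfolding times_centre_def
    by (rule Abs_centre_inverse) (blast intro: mult comm)
  show "Rep_centre (inverse a) = inverse (Rep_centre a)"
    unfolding inverse_centre_def by (rule Abs_centre_inverse) (blast intro: inv)
  show "Rep_centre (a div b) = Rep_centre a / Rep_centre b"
    unfolding divide_centre_def divide_inverse
    by (rule Abs_centre_inverse) (blast intro: mult comm inv)
qed

instance
proof
  fix a b c :: "'a centre"
  show "a * b = b * a"
    unfolding Rep_centre_inject[symmetric] Rep_centre_simps by (rule Rep_centre_commutes)
  show "a \<noteq> 0 \<Longrightarrow> inverse a * a = 1"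
    by (simp add: Rep_centre_inject[symmetric])
  show "a div b = a * inverse b"
    by (simp add: Rep_centre_inject[symmetric] divide_inverse)
qed (simp_all add: Rep_centre_inject[symmetric] mult.assoc distrib_right add_ac)

end

definition centre_scale :: "'a::division_ring centre \<Rightarrow> 'a \<Rightarrow> 'a"  (infixr \<open>*\<^sub>F\<close> 75)
  where "a *\<^sub>F x = Rep_centre a * x"

interpretation H: vector_space "centre_scale :: 'a::division_ring centre \<Rightarrow> 'a \<Rightarrow> 'a"
  by unfold_locales (simp_all add: centre_scale_def distrib_left distrib_right mult.assoc)

text \<open>
  A quaternion algebra over a field \<open>F\<close> is a central simple \<open>F\<close>-algebra of dimension \<open>4\<close>.
  A skew field is simple, and the scalars here form its full centre, so only the dimension
  is left to be required.  The dimension is \<open>0\<close> by convention if there is no finite basis.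
\<close>

definition quaternion_skew_field :: "'a::division_ring itself \<Rightarrow> bool"
  where "quaternion_skew_field _ \<longleftrightarrow> H.dim (UNIV :: 'a set) = 4"


section \<open>The projective space of a skew field and its left and right parallelism\<close>

text \<open>A point \<open>p\<close> and a line \<open>M\<close> are incident if \<open>p \<subseteq> M\<close>.\<close>

definition points :: "'a::division_ring set set"
  where "points = {p. H.subspace p \<and> H.dim p = 1}"

definition lines :: "'a::division_ring set set"
  where "lines = {M. H.subspace M \<and> H.dim M = 2}"

definition left_parallel :: "('a::division_ring set \<times> 'a set) set"
  where "left_parallel = {(M, N). M \<in> lines \<and> N \<in> lines \<and> (\<exists>c. c \<noteq> 0 \<and> (\<lambda>x. c * x) ` M = N)}"

definition right_parallel :: "('a::division_ring set \<times> 'a set) set"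
  where "right_parallel = {(M, N). M \<in> lines \<and> N \<in> lines \<and> (\<exists>d. d \<noteq> 0 \<and> (\<lambda>x. x * d) ` M = N)}"

definition left_class :: "'a::division_ring set \<Rightarrow> 'a set set"
  where "left_class M = left_parallel `` {M}"

definition right_class :: "'a::division_ring set \<Rightarrow> 'a set set"
  where "right_class M = right_parallel `` {M}"


section \<open>Clifford-like parallelisms\<close>

definition parallelism :: "('a::division_ring set \<times> 'a set) set \<Rightarrow> bool"
  where "parallelism par \<longleftrightarrow>
    equiv lines par \<and> (\<forall>p\<in>points. \<forall>C\<in>lines // par. \<exists>!M. M \<in> C \<and> p \<subseteq> M)"

definition clifford_like :: "('a::division_ring set \<times> 'a set) set \<Rightarrow> bool"
  where "clifford_like par \<longleftrightarrow>
    parallelism par \<and>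
    (\<forall>M\<in>lines. \<forall>N\<in>lines.
      (M, N) \<in> par \<longrightarrow> (M, N) \<in> left_parallel \<or> (M, N) \<in> right_parallel)"

text \<open>The point \<open>F1\<close> is the \<open>F\<close>-span of \<open>1\<close>, and \<open>star_one\<close> is \<open>\<A>(H)\<close>.\<close>

definition star_one :: "'a::division_ring set set"
  where "star_one = {M \<in> lines. H.span {1} \<subseteq> M}"

definition conj_closure :: "'a::division_ring set set \<Rightarrow> 'a set set"
  where "conj_closure D = (\<Union>X\<in>D. \<Union>c\<in>- {0}. {(\<lambda>x. inverse c * x * c) ` X})"

definition Pi_classes :: "'a::division_ring set set \<Rightarrow> 'a set set set"
  where "Pi_classes \<F> = {left_class L | L. L \<in> \<F>} \<union> {right_class L | L. L \<in> star_one - \<F>}"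

text \<open>\<open>par_of \<F>\<close> is the relation \<open>\<parallel>\<^sub>\<F>\<close>.\<close>

definition par_of :: "'a::division_ring set set \<Rightarrow> ('a set \<times> 'a set) set"
  where "par_of \<F> = {(M, N). \<exists>C\<in>Pi_classes \<F>. M \<in> C \<and> N \<in> C}"

end

theory Submission
  imports Defs "HOL-Library.Disjoint_Sets"
begin

text \<open>
  The dimension four enters in one place: every line \<open>L\<close> through \<open>F1\<close> is the centralizer of
  one of its elements outside \<open>F\<close> (\<open>star_one_eq_centralizer\<close>), so \<open>L\<close> is a subfield of \<open>H\<close>.
  Two left cosets \<open>bL\<close> and \<open>cL\<close> with nonzero \<open>b\<close>, \<open>c\<close> therefore either coincide or meet only
  in \<open>0\<close>, and \<open>bL\<close> is the only line of the left class of \<open>L\<close> through the point \<open>Fb\<close>; likewise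
  on the right with \<open>Lb\<close> (\<open>left_class_line_through\<close>, \<open>right_class_line_through\<close>).

  A line \<open>M\<close> with a nonzero vector \<open>m\<close> belongs to the left class of \<open>m\<^sup>-\<^sup>1M\<close> and to the right
  class of \<open>Mm\<^sup>-\<^sup>1\<close>, and to no other left or right class of a line through \<open>F1\<close>.  These
  two lines are conjugate.  A conjugation-invariant set \<open>\<F>\<close> contains both or neither, which is
  why the left classes over \<open>\<F>\<close> and the right classes over its complement fit together to a
  partition of the set of lines (\<open>partition_on_Pi_classes\<close>).

  For the converse, let \<open>C\<close> be the class of a line \<open>L\<close> through \<open>F1\<close> under a Clifford-like
  parallelism.  Through each point \<open>Fb\<close> it has one line, which is \<open>bL\<close> or \<open>Lb\<close>.  If both choices
  genuinely occurred, say \<open>Lp \<noteq> pL\<close> and \<open>qL \<noteq> Lq\<close>, then \<open>Lp\<close> and \<open>qL\<close> would have to be left or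
  right parallel, and uniqueness of the line through \<open>p\<close> or \<open>q\<close> forbids this.  Hence \<open>C\<close> is
  the whole left or the whole right class of \<open>L\<close> (\<open>clifford_like_class\<close>).  The lines \<open>L\<close> with left
  type form a conjugation-invariant set, because \<open>c\<^sup>-\<^sup>1L\<close> is right parallel to the conjugate
  \<open>c\<^sup>-\<^sup>1Lc\<close>, so that two different types would merge the classes of these two lines.

  Finally \<open>\<F>\<close> can be read off from its parallelism, since the left and the right class of a line
  \<open>L\<close> through \<open>F1\<close> never coincide: otherwise \<open>L\<close> would be a proper noncentral subfield
  normalized by every element of \<open>H\<close>, against the Cartan-Brauer-Hua theorem
  (\<open>star_one_not_normal\<close>).
\<close>

abbreviation lmul :: "'a::division_ring \<Rightarrow> 'a set \<Rightarrow> 'a set"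
  where "lmul c M \<equiv> (\<lambda>x. c * x) ` M"

abbreviation rmul :: "'a::division_ring set \<Rightarrow> 'a \<Rightarrow> 'a set"
  where "rmul M c \<equiv> (\<lambda>x. x * c) ` M"

abbreviation conjugate :: "'a::division_ring \<Rightarrow> 'a set \<Rightarrow> 'a set"
  where "conjugate c M \<equiv> (\<lambda>x. inverse c * x * c) ` M"

lemma inverse_cancel [simp]:
  fixes c :: "'a::division_ring"
  assumes "c \<noteq> 0"
  shows "inverse c * (c * x) = x" "c * (inverse c * x) = x"
  using assms by (simp_all flip: mult.assoc)

lemma mult_Rep_centre_left: "x * (Rep_centre k * y) = Rep_centre k * (x * y)"
  by (metis Rep_centre_commutes mult.assoc)

section \<open>Points and lines in terms of vectors\<close>

lemma linear_injective_image_line: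
  fixes M :: "'a::division_ring set"
  assumes "M \<in> lines" "Vector_Spaces.linear centre_scale centre_scale f" "inj f"
  shows "f ` M \<in> lines"
proof -
  interpret vector_space_pair "centre_scale :: 'a centre \<Rightarrow> 'a \<Rightarrow> 'a" centre_scale ..
  obtain B where B: "B \<subseteq> M" "H.independent B" "M \<subseteq> H.span B" "card B = 2"
    using H.basis_exists[of M] assms(1) by (auto simp: lines_def)
  have "H.independent (f ` B)"
    using linear_independent_injective_image[OF assms(2) B(2)] assms(3)
    by (auto intro: inj_on_subset)
  moreover have "card (f ` B) = 2"
    using B(4) assms(3) card_image inj_on_subset by (metis subset_UNIV)
  moreover have "f ` M \<subseteq> H.span (f ` B)"
    using linear_span_image[OF assms(2), of B] B(3) by blast
  moreover have "H.subspace (f ` M)"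
    using linear_subspace_image[OF assms(2)] assms(1) by (simp add: lines_def)
  ultimately show ?thesis
    using B(1) by (auto simp: lines_def intro!: H.dim_unique[of "f ` B"])
qed

lemma lmul_line:
  assumes "M \<in> lines" "c \<noteq> 0"
  shows "lmul c M \<in> lines"
proof (rule linear_injective_image_line[OF assms(1)])
  show "Vector_Spaces.linear centre_scale centre_scale ((*) c)"
    by unfold_locales (simp_all add: distrib_left centre_scale_def mult_Rep_centre_left)
qed (use assms in \<open>auto intro: injI\<close>)

lemma rmul_line:
  assumes "M \<in> lines" "c \<noteq> 0"
  shows "rmul M c \<in> lines"
proof (rule linear_injective_image_line[OF assms(1)])
  show "Vector_Spaces.linear centre_scale centre_scale (\<lambda>x. x * c)"
    by unfold_locales (simp_all add: distrib_right centre_scale_def mult.assoc)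
qed (use assms in \<open>auto intro: injI\<close>)

lemma left_parallel_lmul: "M \<in> lines \<Longrightarrow> c \<noteq> 0 \<Longrightarrow> (M, lmul c M) \<in> left_parallel"
  using lmul_line by (auto simp: left_parallel_def)

lemma right_parallel_rmul: "M \<in> lines \<Longrightarrow> c \<noteq> 0 \<Longrightarrow> (M, rmul M c) \<in> right_parallel"
  using rmul_line by (auto simp: right_parallel_def)

lemma left_class_eq: "L \<in> lines \<Longrightarrow> left_class L = {lmul c L | c. c \<noteq> 0}"
  unfolding left_class_def left_parallel_def using lmul_line by fastforce

lemma right_class_eq: "L \<in> lines \<Longrightarrow> right_class L = {rmul L c | c. c \<noteq> 0}"
  unfolding right_class_def right_parallel_def using rmul_line by fastforce

lemma line_nonzero:
  assumes "M \<in> lines"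
  obtains m where "m \<in> M" "m \<noteq> 0"
proof -
  have "\<not> M \<subseteq> {0}"
  proof
    assume "M \<subseteq> {0}"
    then have "H.dim M \<le> card ({} :: 'a set)" by (intro H.dim_le_card) auto
    with assms show False by (simp add: lines_def)
  qed
  then show ?thesis using that by auto
qed

lemma points_eq: "points = (\<lambda>b :: 'a::division_ring. H.span {b}) ` (- {0})"
proof (intro equalityI subsetI)
  fix p :: "'a set" assume p: "p \<in> points"
  obtain B where B: "B \<subseteq> p" "H.independent B" "p \<subseteq> H.span B" "card B = 1"
    using H.basis_exists[of p] p by (auto simp: points_def)
  then obtain b where b: "B = {b}" using card_1_singletonE by blast
  have "p = H.span {b}"
    using B b p H.span_minimal[of "{b}" p] by (auto simp: points_def)
  moreover have "b \<noteq> 0" using B b H.dependent_zero by blast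
  ultimately show "p \<in> (\<lambda>b. H.span {b}) ` (- {0})" by blast
next
  fix p :: "'a set" assume "p \<in> (\<lambda>b. H.span {b}) ` (- {0})"
  then show "p \<in> points" by (auto simp: points_def H.dim_eq_card_independent)
qed

lemma span_singleton_subset_line: "M \<in> lines \<Longrightarrow> H.span {b} \<subseteq> M \<longleftrightarrow> b \<in> M"
  using H.span_minimal[of "{b}" M] H.span_base[of b "{b}"] by (auto simp: lines_def)

text \<open>
  Incidence of a point with a line is membership of any nonzero vector of the point, so the
  axiom on points becomes an axiom on nonzero vectors.
\<close>

lemma parallelism_iff:
  "parallelism par \<longleftrightarrow>
    equiv lines par \<and> (\<forall>b. b \<noteq> 0 \<longrightarrow> (\<forall>C\<in>lines // par. \<exists>!M. M \<in> C \<and> b \<in> M))"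
proof (cases "equiv lines par")
  case True
  have "M \<in> C \<and> H.span {b} \<subseteq> M \<longleftrightarrow> M \<in> C \<and> b \<in> M" if "C \<in> lines // par" for C M b
    using in_quotient_imp_subset[OF True that] span_singleton_subset_line by blast
  then have "(\<exists>!M. M \<in> C \<and> H.span {b} \<subseteq> M) \<longleftrightarrow> (\<exists>!M. M \<in> C \<and> b \<in> M)"
    if "C \<in> lines // par" for C b
    using that by presburger
  then show ?thesis
    unfolding parallelism_def points_eq using True by simp (simp add: Ball_def)
qed (simp add: parallelism_def)

lemma clifford_like_line_through:
  "clifford_like par \<Longrightarrow> C \<in> lines // par \<Longrightarrow> b \<noteq> 0 \<Longrightarrow> \<exists>!M. M \<in> C \<and> b \<in> M"
  by (simp add: clifford_like_def parallelism_iff)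

section \<open>The star of lines through the unit\<close>

lemma star_one_iff: "L \<in> star_one \<longleftrightarrow> L \<in> lines \<and> 1 \<in> L"
  unfolding star_one_def using span_singleton_subset_line by blast

lemma star_one_of_left_coset:
  assumes "M \<in> lines" "m \<in> M" "m \<noteq> 0"
  shows "lmul (inverse m) M \<in> star_one"
  using assms lmul_line[of M "inverse m"] by (force simp: star_one_iff)

lemma conjugate_star_one:
  assumes "L \<in> star_one" "c \<noteq> 0"
  shows "conjugate c L \<in> star_one"
proof -
  have "rmul (lmul (inverse c) L) c \<in> lines"
    using assms by (intro rmul_line lmul_line) (auto simp: star_one_iff)
  then show ?thesis
    using assms by (force simp: star_one_iff image_image)
qed

lemma span_one_iff_central: "a \<in> H.span {1} \<longleftrightarrow> (\<forall>x. a * x = x * (a::'a::division_ring))"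
proof
  assume "a \<in> H.span {1}"
  then show "\<forall>x. a * x = x * a"
    by (auto simp: H.span_singleton centre_scale_def Rep_centre_commutes)
next
  assume "\<forall>x. a * x = x * a"
  then have "Rep_centre (Abs_centre a) = a" by (intro Abs_centre_inverse) simp
  then have "a = Abs_centre a *\<^sub>F 1" by (simp add: centre_scale_def)
  then show "a \<in> H.span {1}" unfolding H.span_singleton by blast
qed

section \<open>Conjugation-invariant sets of lines through the unit\<close>

definition conjugation_invariant :: "'a::division_ring set set \<Rightarrow> bool"
  where "conjugation_invariant \<F> \<longleftrightarrow>
    \<F> \<subseteq> star_one \<and> (\<forall>L\<in>\<F>. \<forall>c. c \<noteq> 0 \<longrightarrow> conjugate c L \<in> \<F>)"

lemma conjugation_invariant_conj_closure:
  fixes D :: "'a::division_ring set set"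
  assumes "D \<subseteq> star_one"
  shows "conjugation_invariant (conj_closure D)"
  unfolding conjugation_invariant_def
proof (intro conjI ballI allI impI subsetI)
  fix L assume "L \<in> conj_closure D"
  then show "L \<in> star_one"
    using assms conjugate_star_one by (auto simp: conj_closure_def)
next
  fix L and c :: 'a assume "L \<in> conj_closure D" "c \<noteq> 0"
  then obtain X d where X: "X \<in> D" "d \<noteq> 0" "L = conjugate d X"
    by (auto simp: conj_closure_def)
  have "conjugate c L = conjugate (d * c) X"
    using X \<open>c \<noteq> 0\<close> by (simp add: image_image nonzero_inverse_mult_distrib mult.assoc)
  then show "conjugate c L \<in> conj_closure D"
    using X \<open>c \<noteq> 0\<close> unfolding conj_closure_def by (auto intro!: bexI[of _ "d * c"])
qed

text \<open>
  The sets obtained from the construction are thus exactly the conjugation-invariant ones: each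
  such set is generated by itself.
\<close>

lemma conj_closure_eq:
  assumes "conjugation_invariant \<F>"
  shows "conj_closure \<F> = \<F>"
proof
  show "conj_closure \<F> \<subseteq> \<F>"
    using assms by (auto simp: conj_closure_def conjugation_invariant_def)
  show "\<F> \<subseteq> conj_closure \<F>"
  proof
    fix L assume "L \<in> \<F>"
    then show "L \<in> conj_closure \<F>"
      unfolding conj_closure_def by (intro UN_I[of L] UN_I[of 1]) auto
  qed
qed

lemma conjugate_mem_iff:
  assumes "conjugation_invariant \<F>" "c \<noteq> 0"
  shows "conjugate c L \<in> \<F> \<longleftrightarrow> L \<in> \<F>"
proof
  assume "conjugate c L \<in> \<F>"
  then have "conjugate (inverse c) (conjugate c L) \<in> \<F>"
    using assms nonzero_imp_inverse_nonzero unfolding conjugation_invariant_def by blast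
  then show "L \<in> \<F>" using assms(2) by (simp add: image_image mult.assoc)
qed (use assms in \<open>auto simp: conjugation_invariant_def\<close>)

section \<open>Lines through the unit as maximal commutative subfields\<close>

definition centralizer :: "'a::division_ring \<Rightarrow> 'a set"
  where "centralizer a = {x. x * a = a * x}"

lemma not_central:
  assumes "a \<notin> H.span {1}"
  obtains h where "h \<notin> centralizer a"
  using assms by (force simp: span_one_iff_central centralizer_def)

lemma subspace_centralizer: "H.subspace (centralizer a)"
proof (rule H.subspaceI)
  fix c x assume "x \<in> centralizer a"
  then show "c *\<^sub>F x \<in> centralizer a"
    by (simp add: centralizer_def centre_scale_def mult_Rep_centre_left mult.assoc)
qed (auto simp: centralizer_def distrib_left distrib_right)

lemma centralizer_mult:
  "x \<in> centralizer a \<Longrightarrow> y \<in> centralizer a \<Longrightarrow> x * y \<in> centralizer a"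
  by (simp add: centralizer_def mult.assoc) (simp flip: mult.assoc)

lemma centralizer_inverse: "x \<in> centralizer a \<Longrightarrow> inverse x \<in> centralizer a"
  using inverse_commutes[of x a] by (simp add: centralizer_def)

context
  assumes quaternion: "quaternion_skew_field TYPE('a::division_ring)"
begin

lemma independent_card_le_4:
  assumes "H.independent (B :: 'a set)"
  shows "finite B \<and> card B \<le> 4"
proof -
  obtain U :: "'a set" where U: "UNIV \<subseteq> H.span U" "card U = 4"
    using H.basis_exists[of "UNIV :: 'a set"] quaternion
    by (auto simp: quaternion_skew_field_def)
  then have "finite U" using card.infinite by fastforce
  then show ?thesis using H.independent_span_bound[of U B] assms U by auto
qed

text \<open>
  Let \<open>C\<close> be the centralizer of some noncentral \<open>a \<in> L\<close>.  It is a skew field containing the line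
  \<open>L\<close>, and \<open>H\<close> is a vector space over it of dimension at least two since \<open>a\<close> is not central.  A
  vector of \<open>C\<close> outside \<open>L\<close> would give \<open>C\<close> dimension at least three over \<open>F\<close>, and then \<open>H\<close> would
  have dimension more than four.
\<close>

lemma star_one_eq_centralizer:
  fixes L :: "'a set"
  assumes "L \<in> star_one"
  obtains a where "a \<in> L" "a \<notin> H.span {1}" "L = centralizer a"
proof -
  have sub: "H.subspace L" and one: "1 \<in> L"
    using assms by (auto simp: star_one_iff lines_def)
  obtain B where B: "B \<subseteq> L" "H.independent B" "L \<subseteq> H.span B" "card B = 2"
    using H.basis_exists[of L] assms by (auto simp: star_one_iff lines_def)
  have finB: "finite B" using B(4) card.infinite by fastforce
  have "\<not> L \<subseteq> H.span {1}"
    using H.independent_span_bound[OF _ B(2), of "{1}"] B by auto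
  then obtain a where a: "a \<in> L" "a \<notin> H.span {1}" by blast
  have ind: "H.independent {a, 1}"
    using a(2) by (intro H.independent_insertI) (auto simp: H.independent_empty)
  have a1: "a \<noteq> 1" using a(2) H.span_base[of 1 "{1}"] by auto
  have Lspan: "L \<subseteq> H.span {a, 1}"
  proof
    fix x assume x: "x \<in> L"
    show "x \<in> H.span {a, 1}"
    proof (rule ccontr)
      assume n: "x \<notin> H.span {a, 1}"
      then have "H.independent {x, a, 1}" using ind by (rule H.independent_insertI)
      then have "card {x, a, 1} \<le> 2"
        using H.independent_span_bound[OF finB, of "{x, a, 1}"] B x a one by auto
      moreover have "x \<noteq> a" "x \<noteq> 1" using n by (auto simp: H.span_base)
      ultimately show False using a1 by simp
    qed
  qed
  let ?C = "centralizer a"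
  have C1: "1 \<in> ?C" "a \<in> ?C" by (auto simp: centralizer_def)
  have "L \<subseteq> ?C"
    using Lspan H.span_minimal[of "{a, 1}" ?C] subspace_centralizer C1 by blast
  moreover have "?C \<subseteq> L"
  proof (rule ccontr)
    assume "\<not> ?C \<subseteq> L"
    then obtain c where c: "c \<in> ?C" "c \<notin> L" by blast
    have "{a, 1} \<subseteq> L" using a one by auto
    then have cn: "c \<notin> H.span {a, 1}" using c(2) H.span_minimal[OF _ sub] by blast
    then have ind3: "H.independent {c, a, 1}" using ind by (rule H.independent_insertI)
    obtain h where h: "h \<notin> ?C" using not_central[OF a(2)] .
    have span3: "H.span {c, a, 1} \<subseteq> ?C"
      using c C1 by (intro H.span_minimal subspace_centralizer) auto
    then have hn: "h \<notin> H.span {c, a, 1}" using h by blast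
    then have ind4: "H.independent {h, c, a, 1}" using ind3 by (rule H.independent_insertI)
    \<comment> \<open>The sum of \<open>C\<close> and \<open>Ch\<close> is direct, so three independent vectors of \<open>C\<close> and the vectors
      \<open>h\<close>, \<open>ah\<close> of \<open>Ch\<close> are five independent vectors.\<close>
    have ahn: "a * h \<notin> H.span {h, c, a, 1}"
    proof
      assume "a * h \<in> H.span {h, c, a, 1}"
      then obtain k where "a * h - k *\<^sub>F h \<in> H.span {c, a, 1}"
        unfolding H.span_breakdown_eq[of _ h] by blast
      then have 1: "(a - Rep_centre k) * h \<in> ?C"
        using span3 by (auto simp: centre_scale_def left_diff_distrib)
      have 2: "a - Rep_centre k \<in> ?C"
        by (simp add: centralizer_def left_diff_distrib right_diff_distrib Rep_centre_commutes)
      have 3: "a - Rep_centre k \<noteq> 0"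
        using a(2) by (auto simp: span_one_iff_central Rep_centre_commutes)
      have "inverse (a - Rep_centre k) * ((a - Rep_centre k) * h) \<in> ?C"
        by (intro centralizer_mult centralizer_inverse 1 2)
      then show False using h 3 by simp
    qed
    have "H.independent {a * h, h, c, a, 1}"
      using ahn ind4 by (rule H.independent_insertI)
    from independent_card_le_4[OF this] have "card {a * h, h, c, a, 1} \<le> 4" by simp
    moreover have "a * h \<notin> {h, c, a, 1}" "h \<notin> {c, a, 1}" "c \<notin> {a, 1}"
      using ahn hn cn by (meson H.span_base)+
    ultimately show False using a1 by simp
  qed
  ultimately show ?thesis using that a by blast
qed

lemma star_one_mult:
  fixes L :: "'a set"
  assumes "L \<in> star_one" "x \<in> L" "y \<in> L"
  shows "x * y \<in> L"
  using star_one_eq_centralizer[OF assms(1)] centralizer_mult assms(2,3) by metis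

lemma star_one_inverse:
  fixes L :: "'a set"
  assumes "L \<in> star_one" "x \<in> L"
  shows "inverse x \<in> L"
  using star_one_eq_centralizer[OF assms(1)] centralizer_inverse assms(2) by metis

text \<open>
  This is the elementary argument for the Cartan-Brauer-Hua theorem.  For \<open>c\<close> outside \<open>L\<close> and
  noncentral \<open>a\<close> with centralizer \<open>L\<close>, conjugation by \<open>c\<close> and by \<open>c + 1\<close> would both preserve
  \<open>L\<close>, and comparing their effect on \<open>a\<close> expresses \<open>c\<close> as a quotient
  of elements of \<open>L\<close> unless \<open>c\<close> commutes with \<open>a\<close>.
\<close>

lemma star_one_not_normal:
  fixes L :: "'a set"
  assumes "L \<in> star_one"
  obtains c where "c \<noteq> 0" "lmul c L \<noteq> rmul L c"
proof -
  obtain a where a: "a \<in> L" "a \<notin> H.span {1}" and L: "L = centralizer a"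
    using star_one_eq_centralizer[OF assms] .
  obtain c where c: "c \<notin> L" using not_central[OF a(2)] unfolding L .
  have 1: "1 \<in> L" "-1 \<in> L" by (auto simp: L centralizer_def)
  have diff: "x - y \<in> L" if "x \<in> L" "y \<in> L" for x y
    using that by (auto simp: L subspace_centralizer H.subspace_diff)
  have nz: "c \<noteq> 0" "c + 1 \<noteq> 0"
    using c diff[OF 1(1) 1(1)] 1 by (auto simp: add_eq_0_iff2)
  show ?thesis
  proof (rule ccontr)
    assume "\<not> thesis"
    then have eq: "lmul c L = rmul L c" "lmul (c + 1) L = rmul L (c + 1)"
      using that nz by blast+
    obtain k where k: "k \<in> L" "c * a = k * c" using eq(1) a(1) by blast
    obtain k' where k': "k' \<in> L" "(c + 1) * a = k' * (c + 1)" using eq(2) a(1) by blast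
    have key: "(k - k') * c = k' - a"
      using k(2) k'(2) by (simp add: algebra_simps)
    show False
    proof (cases "k = k'")
      case True
      then have "c * a = a * c" using key k by simp
      then show False using c by (simp add: L centralizer_def)
    next
      case False
      have "inverse (k - k') * (k' - a) \<in> L"
        by (intro star_one_mult[OF assms] star_one_inverse[OF assms] diff k k' a)
      then show False using c False by (simp flip: key)
    qed
  qed
qed

section \<open>Left and right classes\<close>

text \<open>
  As \<open>L\<close> is a subfield, \<open>b \<in> cL\<close> forces \<open>cL = bL\<close>.  This says at once that left parallelism has a
  unique line through \<open>b\<close> and what this line is.
\<close>

lemma left_class_line_through:
  fixes L :: "'a set"
  assumes "L \<in> star_one" "b \<noteq> 0"
  shows "M \<in> left_class L \<and> b \<in> M \<longleftrightarrow> M = lmul b L"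
proof
  assume "M \<in> left_class L \<and> b \<in> M"
  then obtain c l where c: "c \<noteq> 0" "M = lmul c L" "l \<in> L" "b = c * l"
    using assms by (auto simp: left_class_eq star_one_iff)
  then have l: "l \<noteq> 0" using assms by auto
  have "c * x = b * (inverse l * x)" "b * x = c * (l * x)" for x
    using l c by (simp_all add: mult.assoc)
  moreover have "inverse l * x \<in> L" "l * x \<in> L" if "x \<in> L" for x
    using star_one_mult[OF assms(1)] star_one_inverse[OF assms(1)] c(3) that by blast+
  ultimately show "M = lmul b L" unfolding c(2) by blast
next
  assume "M = lmul b L"
  then show "M \<in> left_class L \<and> b \<in> M"
    using assms by (auto simp: left_class_eq star_one_iff intro!: image_eqI[of _ _ 1])
qed

lemma right_class_line_through:
  fixes L :: "'a set"
  assumes "L \<in> star_one" "b \<noteq> 0"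
  shows "M \<in> right_class L \<and> b \<in> M \<longleftrightarrow> M = rmul L b"
proof
  assume "M \<in> right_class L \<and> b \<in> M"
  then obtain c l where c: "c \<noteq> 0" "M = rmul L c" "l \<in> L" "b = l * c"
    using assms by (auto simp: right_class_eq star_one_iff)
  then have l: "l \<noteq> 0" using assms by auto
  have "x * c = x * inverse l * b" "x * b = x * l * c" for x
    using l c by (simp_all add: mult.assoc)
  moreover have "x * inverse l \<in> L" "x * l \<in> L" if "x \<in> L" for x
    using star_one_mult[OF assms(1)] star_one_inverse[OF assms(1)] c(3) that by blast+
  ultimately show "M = rmul L b" unfolding c(2) by blast
next
  assume "M = rmul L b"
  then show "M \<in> right_class L \<and> b \<in> M"
    using assms by (auto simp: right_class_eq star_one_iff intro!: image_eqI[of _ _ 1])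
qed

text \<open>
  Read from the side of a line \<open>M\<close>: exactly one left and one right class contain it, and their
  representatives through the unit come from scaling any nonzero vector of \<open>M\<close> to \<open>1\<close>.
\<close>

lemma mem_left_class_iff:
  fixes L :: "'a set"
  assumes "L \<in> star_one" "m \<in> M" "m \<noteq> 0"
  shows "M \<in> left_class L \<longleftrightarrow> L = lmul (inverse m) M"
proof -
  have "M \<in> left_class L \<longleftrightarrow> M = lmul m L"
    using left_class_line_through[OF assms(1,3), of M] assms(2) by blast
  also have "\<dots> \<longleftrightarrow> L = lmul (inverse m) M"
    using assms(3) by (auto simp: image_image)
  finally show ?thesis .
qed

lemma mem_right_class_iff:
  fixes L :: "'a set"
  assumes "L \<in> star_one" "m \<in> M" "m \<noteq> 0"
  shows "M \<in> right_class L \<longleftrightarrow> L = rmul M (inverse m)"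
proof -
  have "M \<in> right_class L \<longleftrightarrow> M = rmul L m"
    using right_class_line_through[OF assms(1,3), of M] assms(2) by blast
  also have "\<dots> \<longleftrightarrow> L = rmul M (inverse m)"
    using assms(3) by (auto simp: image_image mult.assoc)
  finally show ?thesis .
qed

lemma self_mem_class:
  fixes L :: "'a set"
  assumes "L \<in> star_one"
  shows "L \<in> left_class L" "L \<in> right_class L"
  using assms left_class_line_through[of L 1 L] right_class_line_through[of L 1 L] by auto

lemma left_class_neq_right_class:
  fixes L :: "'a set"
  assumes "L \<in> star_one"
  shows "left_class L \<noteq> right_class L"
  using star_one_not_normal[OF assms] left_class_line_through[OF assms]
    right_class_line_through[OF assms] by metis

section \<open>Conjugation-invariant sets of lines yield Clifford-like parallelisms\<close>

text \<open>
  The representatives of the left and of the right class of a line are conjugate, so invariance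
  of \<open>\<F>\<close> makes exactly one of these two classes a member of \<^term>\<open>Pi_classes \<F>\<close>.
\<close>

lemma partition_on_Pi_classes:
  assumes inv: "conjugation_invariant \<F>"
  shows "partition_on (lines :: 'a set set) (Pi_classes \<F>)"
proof (rule partition_onI)
  have star: "L \<in> star_one" if "L \<in> \<F>" for L
    using inv that by (auto simp: conjugation_invariant_def)
  have sub: "C \<subseteq> lines" if "C \<in> Pi_classes \<F>" for C
    using that by (auto simp: Pi_classes_def left_class_def right_class_def
        left_parallel_def right_parallel_def)
  have cover: "\<exists>C. C \<in> Pi_classes \<F> \<and> M \<in> C" and
    unique: "C \<in> Pi_classes \<F> \<Longrightarrow> M \<in> C \<Longrightarrow> C' \<in> Pi_classes \<F> \<Longrightarrow> M \<in> C' \<Longrightarrow> C = C'"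
    if M: "M \<in> lines" for M C C'
  proof -
    obtain m where m: "m \<in> M" "m \<noteq> 0" using line_nonzero[OF M] .
    define L where "L = lmul (inverse m) M"
    define R where "R = rmul M (inverse m)"
    have LR: "R = conjugate (inverse m) L"
      unfolding L_def R_def using m by (simp add: image_image)
    have L: "L \<in> star_one"
      unfolding L_def using star_one_of_left_coset M m by blast
    then have R: "R \<in> star_one"
      unfolding LR by (rule conjugate_star_one) (use m in simp)
    have RL: "R \<in> \<F> \<longleftrightarrow> L \<in> \<F>"
      unfolding LR by (rule conjugate_mem_iff[OF inv]) (use m in simp)
    have iff: "M \<in> left_class K \<longleftrightarrow> K = L" "M \<in> right_class K \<longleftrightarrow> K = R"
      if "K \<in> star_one" for K
      using that m mem_left_class_iff mem_right_class_iff unfolding L_def R_def by blast+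
    show "\<exists>C. C \<in> Pi_classes \<F> \<and> M \<in> C"
      using L R RL iff unfolding Pi_classes_def by blast
    have "C = (if L \<in> \<F> then left_class L else right_class R)"
      if "C \<in> Pi_classes \<F>" "M \<in> C" for C
      using that RL iff star unfolding Pi_classes_def by auto
    then show "C \<in> Pi_classes \<F> \<Longrightarrow> M \<in> C \<Longrightarrow> C' \<in> Pi_classes \<F> \<Longrightarrow> M \<in> C' \<Longrightarrow> C = C'"
      by metis
  qed
  show "\<Union> (Pi_classes \<F>) = lines" using cover sub by blast
  show "disjnt C C'" if "C \<in> Pi_classes \<F>" "C' \<in> Pi_classes \<F>" "C \<noteq> C'" for C C'
    using that unique sub unfolding disjnt_iff by blast
  show "{} \<notin> Pi_classes \<F>"
    using self_mem_class star unfolding Pi_classes_def by blast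
qed

lemma equiv_par_of:
  fixes \<F> :: "'a set set"
  assumes "conjugation_invariant \<F>"
  shows "equiv lines (par_of \<F>)" "lines // par_of \<F> = Pi_classes \<F>"
  using equiv_partition_on[OF partition_on_Pi_classes[OF assms]]
    partition_on_eq_quotient[OF partition_on_Pi_classes[OF assms]]
  unfolding par_of_def by auto

lemma clifford_like_par_of:
  assumes inv: "conjugation_invariant \<F>"
  shows "clifford_like (par_of \<F> :: ('a set \<times> 'a set) set)"
  unfolding clifford_like_def parallelism_iff
proof (intro conjI ballI allI impI)
  show "equiv lines (par_of \<F>)" by (rule equiv_par_of[OF inv])
next
  fix b :: 'a and C assume b: "b \<noteq> 0" and "C \<in> lines // par_of \<F>"
  then have "C \<in> Pi_classes \<F>" using equiv_par_of[OF inv] by simp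
  then obtain L where L: "L \<in> star_one" and "C = left_class L \<or> C = right_class L"
    using inv by (auto simp: Pi_classes_def conjugation_invariant_def)
  then show "\<exists>!M. M \<in> C \<and> b \<in> M"
    by (elim disjE) (simp_all add: left_class_line_through[OF L b] right_class_line_through[OF L b])
next
  fix M N :: "'a set"
  assume MN: "(M, N) \<in> par_of \<F>"
  obtain L where L: "L \<in> star_one" and
    C: "M \<in> left_class L \<and> N \<in> left_class L \<or> M \<in> right_class L \<and> N \<in> right_class L"
    using MN inv by (auto simp: par_of_def Pi_classes_def conjugation_invariant_def)
  then have Ll: "L \<in> lines" by (simp add: star_one_iff)
  have l: "(lmul c L, lmul d L) \<in> left_parallel" if "c \<noteq> 0" "d \<noteq> 0" for c d
  proof -
    have "(lmul c L, lmul (d * inverse c) (lmul c L)) \<in> left_parallel"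
      using that by (intro left_parallel_lmul lmul_line Ll) auto
    then show ?thesis using that by (simp add: image_image mult.assoc)
  qed
  have r: "(rmul L c, rmul L d) \<in> right_parallel" if "c \<noteq> 0" "d \<noteq> 0" for c d
  proof -
    have "(rmul L c, rmul (rmul L c) (inverse c * d)) \<in> right_parallel"
      using that by (intro right_parallel_rmul rmul_line Ll) auto
    then show ?thesis using that by (simp add: image_image mult.assoc)
  qed
  show "(M, N) \<in> left_parallel \<or> (M, N) \<in> right_parallel"
    using C l r unfolding left_class_eq[OF Ll] right_class_eq[OF Ll] by blast
qed

section \<open>Every Clifford-like parallelism arises in this way\<close>

text \<open>
  Each line of the class of \<open>L\<close> is left or right parallel to \<open>L\<close>, but the type could depend on
  the line.  It does not: the lines of the class are also left or right parallel to each other.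
\<close>

lemma clifford_like_class:
  assumes cl: "clifford_like (par :: ('a set \<times> 'a set) set)" and L: "L \<in> star_one"
  shows "par `` {L} = left_class L \<or> par `` {L} = right_class L"
proof -
  let ?C = "par `` {L}"
  have eq: "equiv lines par"
    using cl by (simp add: clifford_like_def parallelism_def)
  have Ll: "L \<in> lines" using L by (simp add: star_one_iff)
  have lines: "?C \<subseteq> lines" using eq by (auto simp: equiv_def)
  have through: "\<exists>!M. M \<in> ?C \<and> b \<in> M" if "b \<noteq> 0" for b
    using clifford_like_line_through[OF cl quotientI[OF Ll] that] .
  have LR: "N \<in> left_parallel `` {M} \<or> N \<in> right_parallel `` {M}" if "M \<in> ?C" "N \<in> ?C" for M N
  proof -
    have "(M, N) \<in> par"
      using that eq by (meson Image_singleton_iff equivE symE transE)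
    then show ?thesis
      using cl that lines unfolding clifford_like_def by blast
  qed
  have Lself: "L \<in> ?C" using eq Ll by (rule equiv_class_self)
  have coset: "lmul b L \<in> ?C \<or> rmul L b \<in> ?C" if b: "b \<noteq> 0" for b
  proof -
    obtain M where M: "M \<in> ?C" "b \<in> M" using through[OF b] by blast
    then have "M \<in> left_class L \<or> M \<in> right_class L"
      using LR[OF Lself] unfolding left_class_def right_class_def by blast
    then show ?thesis
      using M left_class_line_through[OF L b] right_class_line_through[OF L b] by metis
  qed
  have in_coset: "b \<in> lmul b L" "b \<in> rmul L b" for b
    using L by (auto simp: star_one_iff intro!: image_eqI[of _ _ 1])
  \<comment> \<open>Two lines of proper right and proper left type cannot both lie in the class: if \<open>qL = cLp\<close>,
    then \<open>Lp\<close> is left parallel to \<open>L\<close>, hence equal to \<open>pL\<close>; if \<open>qL = Lpc\<close>, then \<open>qL\<close> is right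
    parallel to \<open>L\<close>, hence equal to \<open>Lq\<close>.\<close>
  have not_both: False
    if pq: "p \<noteq> 0" "q \<noteq> 0" "rmul L p \<in> ?C" "lmul q L \<in> ?C"
      "lmul p L \<noteq> rmul L p" "lmul q L \<noteq> rmul L q" for p q
    using LR[OF pq(3,4)]
  proof
    assume "lmul q L \<in> left_parallel `` {rmul L p}"
    then obtain c where "c \<noteq> 0" "lmul q L = lmul c (rmul L p)"
      by (auto simp: left_parallel_def)
    then have "rmul L p = lmul (inverse c) (lmul q L)" by (simp add: image_image)
    then have "rmul L p = lmul (inverse c * q) L" by (simp add: image_image mult.assoc)
    then have "rmul L p \<in> left_class L"
      using \<open>c \<noteq> 0\<close> pq(2) Ll by (auto simp: left_class_eq)
    then show False
      using left_class_line_through[OF L pq(1)] in_coset(2)[of p] pq(5) by metis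
  next
    assume "lmul q L \<in> right_parallel `` {rmul L p}"
    then obtain c where "c \<noteq> 0" "lmul q L = rmul (rmul L p) c"
      by (auto simp: right_parallel_def)
    then have "lmul q L = rmul L (p * c)" by (simp add: image_image mult.assoc)
    then have "lmul q L \<in> right_class L"
      using \<open>c \<noteq> 0\<close> pq(1) Ll by (auto simp: right_class_eq)
    then show False
      using right_class_line_through[OF L pq(2)] in_coset(1)[of q] pq(6) by metis
  qed
  \<comment> \<open>Points with \<open>bL = Lb\<close> fit either alternative.\<close>
  have all: "(\<forall>b. b \<noteq> 0 \<longrightarrow> lmul b L \<in> ?C) \<or> (\<forall>b. b \<noteq> 0 \<longrightarrow> rmul L b \<in> ?C)"
    using coset not_both by metis
  have class_eq: "?C = {f b | b. b \<noteq> 0}"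
    if f: "\<forall>b. b \<noteq> 0 \<longrightarrow> f b \<in> ?C" "\<And>b. b \<in> f b" for f
  proof (intro equalityI subsetI)
    fix M assume M: "M \<in> ?C"
    then obtain b where b: "b \<noteq> 0" "b \<in> M" using lines line_nonzero by blast
    then have "M = f b" using through[OF b(1)] f M by blast
    then show "M \<in> {f b | b. b \<noteq> 0}" using b(1) by blast
  qed (use f in blast)
  from all show ?thesis
    unfolding left_class_eq[OF Ll] right_class_eq[OF Ll]
    using class_eq[of "\<lambda>b. lmul b L"] class_eq[of "\<lambda>b. rmul L b"] in_coset by blast
qed

lemma clifford_like_arises:
  assumes cl: "clifford_like (par :: ('a set \<times> 'a set) set)"
  shows "\<exists>\<F>. conjugation_invariant \<F> \<and> lines // par = Pi_classes \<F> \<and> par = par_of \<F>"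
proof (intro exI conjI)
  define \<F> where "\<F> = {L \<in> star_one. par `` {L} = left_class L}"
  have eq: "equiv lines par"
    using cl by (simp add: clifford_like_def parallelism_def)
  show "conjugation_invariant \<F>"
    unfolding conjugation_invariant_def
  proof (intro conjI ballI allI impI)
    fix L :: "'a set" and c :: 'a assume "L \<in> \<F>" and c: "c \<noteq> 0"
    then have L: "L \<in> star_one" "L \<in> lines" and left: "par `` {L} = left_class L"
      by (auto simp: \<F>_def star_one_iff)
    let ?K = "conjugate c L"
    have K: "?K \<in> star_one" "?K \<in> lines"
      using conjugate_star_one[OF L(1) c] by (auto simp: star_one_iff)
    show "?K \<in> \<F>"
    proof (rule ccontr)
      assume "?K \<notin> \<F>"
      then have right: "par `` {?K} = right_class ?K"
        using K clifford_like_class[OF cl] by (auto simp: \<F>_def)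
      \<comment> \<open>The line \<open>c\<^sup>-\<^sup>1L = Kc\<^sup>-\<^sup>1\<close> would lie in the classes of both \<open>L\<close> and its conjugate \<open>K\<close>.\<close>
      have "lmul (inverse c) L = rmul ?K (inverse c)"
        using c by (simp add: image_image mult.assoc)
      moreover have "inverse c \<noteq> 0" using c by simp
      ultimately have "lmul (inverse c) L \<in> right_class ?K" "lmul (inverse c) L \<in> left_class L"
        unfolding left_class_eq[OF L(2)] right_class_eq[OF K(2)] by blast+
      then have "par `` {L} = par `` {?K}"
        using left right eq by (metis Image_singleton_iff equiv_class_eq)
      then have "?K \<in> left_class L" using left self_mem_class(2)[OF K(1)] right by simp
      then have "?K = L"
        using left_class_line_through[OF L(1), of 1 ?K] K by (simp add: star_one_iff)
      then show False using \<open>?K \<notin> \<F>\<close> \<open>L \<in> \<F>\<close> by simp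
    qed
  qed (auto simp: \<F>_def)
  show quot: "lines // par = Pi_classes \<F>"
  proof -
    \<comment> \<open>Every class has a line through \<open>F1\<close>, so the classes of these lines are all classes.\<close>
    have "\<exists>L\<in>star_one. C = par `` {L}" if C: "C \<in> lines // par" for C
    proof -
      have "\<exists>!M. M \<in> C \<and> 1 \<in> M"
        by (rule clifford_like_line_through[OF cl C one_neq_zero])
      then obtain M where M: "M \<in> C" "1 \<in> M" "M \<in> lines"
        using in_quotient_imp_subset[OF eq C] by blast
      then have "C = par `` {M}"
        using C eq by (metis Image_singleton_iff equiv_class_eq quotientE)
      then show ?thesis using M by (auto simp: star_one_iff)
    qed
    moreover have "par `` {L} \<in> lines // par" if "L \<in> star_one" for L
      using that by (simp add: star_one_iff quotientI)
    ultimately have "lines // par = {par `` {L} | L. L \<in> star_one}" by blast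
    also have "\<dots> = Pi_classes \<F>"
      unfolding Pi_classes_def \<F>_def using clifford_like_class[OF cl] by blast
    finally show ?thesis .
  qed
  show "par = par_of \<F>"
  proof -
    have "(M, N) \<in> par \<longleftrightarrow> (\<exists>C\<in>lines // par. M \<in> C \<and> N \<in> C)" for M N
    proof
      assume MN: "(M, N) \<in> par"
      then have "M \<in> lines" using eq by (auto simp: equiv_def)
      then show "\<exists>C\<in>lines // par. M \<in> C \<and> N \<in> C"
        using MN quotientI[of M lines par] equiv_class_self[OF eq] by blast
    next
      assume "\<exists>C\<in>lines // par. M \<in> C \<and> N \<in> C"
      then show "(M, N) \<in> par" using in_quotient_imp_in_rel[OF eq] by blast
    qed
    then show ?thesis unfolding par_of_def quot by auto
  qed
qed

text \<open>
  The parallelism determines \<open>\<F>\<close>, because for a line through the unit the two possible classes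
  are different.
\<close>

lemma par_of_class:
  assumes inv: "conjugation_invariant \<F>" and L: "(L :: 'a set) \<in> star_one"
  shows "par_of \<F> `` {L} = (if L \<in> \<F> then left_class L else right_class L)"
proof -
  let ?C = "if L \<in> \<F> then left_class L else right_class L"
  have "?C \<in> lines // par_of \<F>" "L \<in> ?C"
    using L self_mem_class[OF L] equiv_par_of[OF inv] by (auto simp: Pi_classes_def)
  then show ?thesis
    using equiv_par_of(1)[OF inv] by (metis Image_singleton_iff equiv_class_eq quotientE)
qed

lemma par_of_inject:
  fixes \<F> :: "'a set set"
  assumes "conjugation_invariant \<F>" "conjugation_invariant \<F>'"
  shows "par_of \<F> = par_of \<F>' \<longleftrightarrow> \<F> = \<F>'"
proof
  assume "par_of \<F> = par_of \<F>'"
  then have "L \<in> \<F> \<longleftrightarrow> L \<in> \<F>'" if "L \<in> star_one" for L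
    using par_of_class[OF assms(1) that] par_of_class[OF assms(2) that]
      left_class_neq_right_class[OF that] by (auto split: if_splits)
  then show "\<F> = \<F>'" using assms unfolding conjugation_invariant_def by blast
qed simp

end

section \<open>The classification of Clifford-like parallelisms\<close>

theorem theorem4p10:
  assumes "quaternion_skew_field TYPE('a::division_ring)"
  shows
    "(\<forall>D \<subseteq> (star_one :: 'a set set).
        clifford_like (par_of (conj_closure D)) \<and>
        lines // par_of (conj_closure D) = Pi_classes (conj_closure D))
     \<and>
     (\<forall>par :: ('a set \<times> 'a set) set. clifford_like par \<longrightarrow>
        (\<exists>D \<subseteq> star_one. lines // par = Pi_classes (conj_closure D) \<and>
                         par = par_of (conj_closure D)))
     \<and>
     (\<forall>D \<subseteq> (star_one :: 'a set set). \<forall>D' \<subseteq> star_one.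
        par_of (conj_closure D) = par_of (conj_closure D') \<longleftrightarrow>
        conj_closure D = conj_closure D')"
proof (intro conjI allI impI)
  fix D :: "'a set set" assume "D \<subseteq> star_one"
  note inv = conjugation_invariant_conj_closure[OF this]
  show "clifford_like (par_of (conj_closure D))"
    by (rule clifford_like_par_of[OF assms inv])
  show "lines // par_of (conj_closure D) = Pi_classes (conj_closure D)"
    by (rule equiv_par_of[OF assms inv])
next
  fix par :: "('a set \<times> 'a set) set" assume "clifford_like par"
  then obtain \<F> where \<F>: "conjugation_invariant \<F>" "lines // par = Pi_classes \<F>"
      "par = par_of \<F>"
    using clifford_like_arises[OF assms] by blast
  then show "\<exists>D\<subseteq>star_one. lines // par = Pi_classes (conj_closure D) \<and>
      par = par_of (conj_closure D)"
    using conj_closure_eq[OF \<F>(1)]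
    by (intro exI[of _ \<F>]) (simp add: conjugation_invariant_def)
next
  fix D D' :: "'a set set" assume "D \<subseteq> star_one" "D' \<subseteq> star_one"
  then show "par_of (conj_closure D) = par_of (conj_closure D') \<longleftrightarrow>
      conj_closure D = conj_closure D'"
    by (intro par_of_inject[OF assms] conjugation_invariant_conj_closure)
qed

end
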